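(* Among the complete multipartite graphs, the primary non-QE graphs are exactly the four graphs $K_{3,2}$, $K_{5,1,1}$, $K_{4,1,1,1}$ and $K_{3,1,1,1,1}$, and their QE constants are $\mathrm{QEC}(K_{3,2})=2/5$, $\mathrm{QEC}(K_{5,1,1})=1/7$, $\mathrm{QEC}(K_{4,1,1,1})=2/7$, $\mathrm{QEC}(K_{3,1,1,1,1})=1/7$. Moreover, every complete multipartite graph of non-QE class contains at least one of these four graphs as an isometrically embedded subgraph.
   Context: Graphs are finite, simple and connected, with graph distance $d_G$ and distance matrix $D=[d_G(x,y)]$. For $|V|\ge2$, $\mathrm{QEC}(G)=\max\{\langle f,Df\rangle : \langle f,f\rangle=1,\ \langle\mathbf{1},f\rangle=0\}$ over real vectors $f$ on $V$. A quadratic embedding of $G=(V,E)$ is a map $\varphi:V\to\mathbb{R}^N$ with $\|\varphi(x)-\varphi(y)\|^2=d_G(x,y)$; $G$ is of QE class if one exists and of non-QE class otherwise (equivalently, by Schoenberg, $\mathrm{QEC}(G)>0$). A (connected) subgraph $H=(V',E')$ of $G$ (i.e. $V'\subset V$, $E'\subset E$) is isometrically embedded if $d_H(x,y)=d_G(x,y)$ for all $x,y\in V'$. A graph of non-QE class is primary if it contains no isometrically embedded proper subgraph of non-QE class. A complete multipartite graph is a complete $k$-partite graph $K_{m_1,\dots,m_k}$ for some $k\ge2$: vertex set the disjoint union of nonempty sets $V_1,\dots,V_k$ with $|V_i|=m_i$, two vertices adjacent iff in different parts. *)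

theory Defs
  imports "HOL-Analysis.Analysis" "Graph_Theory.Graph_Theory"
begin

text \<open>
  A finite simple graph is a \<^locale>\<open>pair_graph\<close>: each undirected edge \<open>xy\<close> is represented by
  the two arcs \<open>(x, y)\<close> and \<open>(y, x)\<close>.  The name \<open>connected\<close> is qualified because
  the topological notion has the same base name.
\<close>

definition connected_graph :: "'a pair_pre_digraph \<Rightarrow> bool" where
  "connected_graph G \<longleftrightarrow> pair_graph G \<and> Digraph_Component.connected (with_proj G)"

text \<open>
  \<open>wf_digraph.\<mu>\<close> is the infimum of the costs of all walks between two vertices; with unit
  arc costs it is the length of a shortest walk, a finite value if the graph is connected.
\<close>

definition gdist :: "'a pair_pre_digraph \<Rightarrow> 'a \<Rightarrow> 'a \<Rightarrow> real" where
  "gdist G x y = real_of_ereal (wf_digraph.\<mu> (with_proj G) (\<lambda>_. 1) x y)"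

text \<open>
  In \<open>QEC\<close>, only the values of \<open>f\<close> on \<open>pverts G\<close> matter.  The \<open>GREATEST\<close> operator denotes an
  attained maximum; unlike a supremum, its value is unspecified if there is no maximum.
\<close>

definition QEC :: "'a pair_pre_digraph \<Rightarrow> real" where
  "QEC G = (GREATEST q. \<exists>f :: 'a \<Rightarrow> real.
     (\<Sum>x\<in>pverts G. f x * f x) = 1 \<and>
     (\<Sum>x\<in>pverts G. f x) = 0 \<and>
     q = (\<Sum>x\<in>pverts G. f x * (\<Sum>y\<in>pverts G. gdist G x y * f y)))"

text \<open>
  As the dimension \<open>N\<close> is existentially quantified, a point of \<open>N\<close>-dimensional Euclidean space
  is given by the coordinates \<open>i < N\<close> of a function on the natural numbers.
\<close>

definition quadratic_embedding ::
  "'a pair_pre_digraph \<Rightarrow> nat \<Rightarrow> ('a \<Rightarrow> nat \<Rightarrow> real) \<Rightarrow> bool" where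
  "quadratic_embedding G N \<phi> \<longleftrightarrow>
     (\<forall>x\<in>pverts G. \<forall>y\<in>pverts G. (\<Sum>i<N. (\<phi> x i - \<phi> y i)\<^sup>2) = gdist G x y)"

definition QE_class :: "'a pair_pre_digraph \<Rightarrow> bool" where
  "QE_class G \<longleftrightarrow> connected_graph G \<and> (\<exists>N \<phi>. quadratic_embedding G N \<phi>)"

definition non_QE_class :: "'a pair_pre_digraph \<Rightarrow> bool" where
  "non_QE_class G \<longleftrightarrow> connected_graph G \<and> \<not> QE_class G"

definition isometric_subgraph :: "'a pair_pre_digraph \<Rightarrow> 'a pair_pre_digraph \<Rightarrow> bool" where
  "isometric_subgraph H G \<longleftrightarrow>
     connected_graph H \<and> subgraph (with_proj H) (with_proj G) \<and>
     (\<forall>x\<in>pverts H. \<forall>y\<in>pverts H. gdist H x y = gdist G x y)"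

definition primary_non_QE :: "'a pair_pre_digraph \<Rightarrow> bool" where
  "primary_non_QE G \<longleftrightarrow>
     non_QE_class G \<and> (\<forall>H. isometric_subgraph H G \<and> H \<noteq> G \<longrightarrow> \<not> non_QE_class H)"

text \<open>
  The complete multipartite graph with part sizes \<open>ms\<close>.  The vertex \<open>(i, a)\<close> is the \<open>a\<close>-th
  element of the \<open>i\<close>-th part, so that two vertices are adjacent iff their first components
  differ.
\<close>

definition K_multi :: "nat list \<Rightarrow> (nat \<times> nat) pair_pre_digraph" where
  "K_multi ms =
     (let V = (SIGMA i:{..<length ms}. {..<ms ! i})
      in \<lparr>pverts = V, parcs = {(x, y). x \<in> V \<and> y \<in> V \<and> fst x \<noteq> fst y}\<rparr>)"

definition is_K_multi :: "nat list \<Rightarrow> 'a pair_pre_digraph \<Rightarrow> bool" where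
  "is_K_multi ms G \<longleftrightarrow> digraph_iso (with_proj G) (with_proj (K_multi ms))"

definition complete_multipartite :: "'a pair_pre_digraph \<Rightarrow> bool" where
  "complete_multipartite G \<longleftrightarrow>
     (\<exists>ms. length ms \<ge> 2 \<and> (\<forall>m\<in>set ms. m \<ge> 1) \<and> is_K_multi ms G)"

end

theory Submission
  imports Defs
begin

text \<open>
  On vectors \<open>f\<close> with sum zero, the distance form of a complete multipartite graph is the sum of
  the squares of the part sums \<open>s\<^sub>i\<close> minus \<open>2 \<parallel>f\<parallel>\<^sup>2\<close>, and by Cauchy--Schwarz
  \<open>\<parallel>f\<parallel>\<^sup>2\<close> is at least the sum of the \<open>s\<^sub>i\<^sup>2 / m\<^sub>i\<close>.  This determines the QE constants; their positivity
  rules out quadratic embeddings.  Conversely, a complete multipartite graph containing none of the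
  four graphs either has only parts of size at most two, or has one larger part of \<open>m\<close> vertices and
  \<open>k\<close> singletons with \<open>k \<le> 1\<close>, or \<open>m \<le> 4\<close> and \<open>k \<le> 2\<close>, or \<open>m \<le> 3\<close> and \<open>k \<le> 3\<close>.  In each case an
  embedding can be written down.  The same dichotomy, applied to the vertex set of a
  proper isometric subgraph, shows that the four graphs are primary, as none of them contains another.
\<close>

section \<open>Graphs given by a vertex labelling\<close>

text \<open>Keeping vertex set and labelling separate lets an induced subgraph of a complete
  multipartite graph be described by shrinking \<open>V\<close> under the same
  \<open>p\<close>.\<close>

definition label_graph :: "'a set \<Rightarrow> ('a \<Rightarrow> 'b) \<Rightarrow> 'a pair_pre_digraph" where
  "label_graph V p = \<lparr>pverts = V, parcs = {(x, y). x \<in> V \<and> y \<in> V \<and> p x \<noteq> p y}\<rparr>"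

text \<open>The formula does not refer to a vertex set; this is what makes passing to a subset with
  at least two labels isometric.\<close>

definition label_dist :: "('a \<Rightarrow> 'b) \<Rightarrow> 'a \<Rightarrow> 'a \<Rightarrow> real" where
  "label_dist p x y = (if x = y then 0 else if p x = p y then 2 else 1)"

lemma pverts_label_graph [simp]: "pverts (label_graph V p) = V"
  and parcs_label_graph [simp]:
    "parcs (label_graph V p) = {(x, y). x \<in> V \<and> y \<in> V \<and> p x \<noteq> p y}"
  by (simp_all add: label_graph_def)

lemma pair_graph_label_graph:
  assumes "finite V"
  shows "pair_graph (label_graph V p)"
proof -
  have "finite {(x, y). x \<in> V \<and> y \<in> V \<and> p x \<noteq> p y}"
    by (rule finite_subset[of _ "V \<times> V"]) (use assms in auto)
  then show ?thesis
    by unfold_locales (use assms in \<open>auto simp: symmetric_def sym_def\<close>)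
qed

lemma wf_digraph_label_graph: "wf_digraph (with_proj (label_graph V p))"
  by unfold_locales auto

lemma awalk_two_parts:
  assumes V: "x \<in> V" "y \<in> V" and parts: "\<forall>u\<in>V. \<exists>v\<in>V. p v \<noteq> p u"
  shows "\<exists>w. pre_digraph.awalk (with_proj (label_graph V p)) x w y \<and>
    real (length w) = label_dist p x y"
proof -
  interpret wf_digraph "with_proj (label_graph V p)" by (rule wf_digraph_label_graph)
  consider "x = y" | "p x \<noteq> p y" | "x \<noteq> y" "p x = p y" by blast
  then show ?thesis
  proof cases
    case 1
    then have "awalk x [] y" using V by (simp add: awalk_def)
    then show ?thesis using 1 by (intro exI[of _ "[]"]) (simp add: label_dist_def)
  next
    case 2
    then have "awalk x [(x, y)] y" using V by (simp add: awalk_def)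
    then show ?thesis using 2 by (intro exI[of _ "[(x, y)]"]) (auto simp: label_dist_def)
  next
    case 3
    obtain z where "z \<in> V" "p z \<noteq> p x" using parts V by blast
    then have "awalk x [(x, z), (z, y)] y" using V 3 by (simp add: awalk_def)
    then show ?thesis
      using 3 by (intro exI[of _ "[(x, z), (z, y)]"]) (simp add: label_dist_def)
  qed
qed

lemma (in wf_digraph) awalk_cost_one: "awalk_cost (\<lambda>_. 1) w = real (length w)"
  by (induction w) (simp_all add: awalk_cost_def)

text \<open>The explicit walks of length 0, 1 and 2 give the upper bound. Conversely, an empty walk
  forces \<open>x = y\<close>, a single arc forces different labels, and no value of
  \<open>label_dist\<close> exceeds two.\<close>

lemma gdist_label_graph:
  assumes V: "x \<in> V" "y \<in> V" and parts: "\<forall>u\<in>V. \<exists>v\<in>V. p v \<noteq> p u"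
  shows "gdist (label_graph V p) x y = label_dist p x y"
proof -
  interpret wf_digraph "with_proj (label_graph V p)" by (rule wf_digraph_label_graph)
  obtain w where w: "awalk x w y" "real (length w) = label_dist p x y"
    using awalk_two_parts[OF assms] by blast
  have lower: "label_dist p x y \<le> real (length w')" if "awalk x w' y" for w'
  proof (cases w')
    case (Cons e es)
    with that show ?thesis
      by (cases es) (auto simp: awalk_def label_dist_def split: prod.splits)
  qed (use that in \<open>auto simp: awalk_def label_dist_def\<close>)
  have "\<mu> (\<lambda>_. 1) x y = ereal (label_dist p x y)"
    unfolding \<mu>_def
  proof (rule INF_eqI)
    fix c assume "\<And>w'. w' \<in> {w'. awalk x w' y} \<Longrightarrow> c \<le> ereal (awalk_cost (\<lambda>_. 1) w')"
    from this[of w] w show "c \<le> ereal (label_dist p x y)" by (simp add: awalk_cost_one)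
  qed (use lower in \<open>auto simp: awalk_cost_one\<close>)
  then show ?thesis by (simp add: gdist_def)
qed

lemma connected_label_graph:
  assumes "finite V" "V \<noteq> {}" and parts: "\<forall>u\<in>V. \<exists>v\<in>V. p v \<noteq> p u"
  shows "connected_graph (label_graph V p)"
proof -
  let ?G = "with_proj (label_graph V p)"
  interpret wf_digraph ?G by (rule wf_digraph_label_graph)
  \<comment> \<open>The arc set is symmetric already, so connectedness is strong connectedness,
    which the explicit walks provide.\<close>
  have "mk_symmetric ?G = label_graph V p"
    by (auto simp: mk_symmetric_def label_graph_def)
  moreover have "strongly_connected ?G"
    using assms(2) awalk_two_parts[OF _ _ parts]
    by (intro strongly_connectedI) (auto simp: reachable_awalk)
  ultimately show ?thesis
    using pair_graph_label_graph[OF assms(1)]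
    by (simp add: connected_graph_def Digraph_Component.connected_def)
qed

lemma gdist_one_imp_arc:
  assumes "connected_graph H" "x \<noteq> y" "gdist H x y = 1"
  shows "(x, y) \<in> parcs H"
proof -
  interpret pair_graph H using assms(1) by (simp add: connected_graph_def)
  \<comment> \<open>\<open>real_of_ereal\<close> sends both infinities to 0, so the real value 1 can
    only come from the extended value 1.\<close>
  have "\<mu> (\<lambda>_. 1) x y = 1"
    using assms(3) unfolding gdist_def by (cases "\<mu> (\<lambda>_. 1) x y") auto
  \<comment> \<open>An infimum below 2 is undercut by a walk of length at most one, and
    \<open>x \<noteq> y\<close> excludes the empty walk.\<close>
  then have "\<mu> (\<lambda>_. 1) x y < 2" by simp
  then obtain w where w: "awalk x w y" "length w < 2"
    unfolding \<mu>_def INF_less_iff by (auto simp: awalk_cost_one)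
  then consider "w = []" | e where "w = [e]"
    by (cases w; cases "tl w") auto
  then show ?thesis
    by cases (use w assms(2) in \<open>auto simp: awalk_def\<close>)
qed

text \<open>Edges are the pairs at distance one, so an isometric subgraph on all vertices keeps
  every edge. Hence a proper isometric subgraph misses a vertex.\<close>

lemma isometric_subgraph_spanning_eq:
  assumes iso: "isometric_subgraph H (label_graph V p)"
    and parts: "\<forall>u\<in>V. \<exists>v\<in>V. p v \<noteq> p u" and "pverts H = V"
  shows "H = label_graph V p"
proof -
  have "(x, y) \<in> parcs H" if "x \<in> V" "y \<in> V" "p x \<noteq> p y" for x y
  proof (rule gdist_one_imp_arc)
    show "gdist H x y = 1"
      using that iso assms(3) gdist_label_graph[OF _ _ parts]
      by (auto simp: isometric_subgraph_def label_dist_def)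
  qed (use that iso in \<open>auto simp: isometric_subgraph_def\<close>)
  moreover have "parcs H \<subseteq> parcs (label_graph V p)"
    using iso by (simp add: isometric_subgraph_def subgraph_def)
  ultimately have "parcs H = parcs (label_graph V p)" by auto
  then show ?thesis using assms(3) by (simp add: pair_pre_digraph.equality)
qed

section \<open>Copies of complete multipartite graphs inside labelled graphs\<close>

abbreviation (input) multi_index :: "nat list \<Rightarrow> (nat \<times> nat) set" where
  "multi_index ms \<equiv> (SIGMA i:{..<length ms}. {..<ms ! i})"

text \<open>The labels \<open>p\<close> may come from a larger vertex set; the image of
  \<open>h\<close> is then an induced copy of \<open>K_multi ms\<close> in it.\<close>

definition realises ::
  "nat list \<Rightarrow> (nat \<times> nat \<Rightarrow> 'a) \<Rightarrow> ('a \<Rightarrow> 'b) \<Rightarrow> bool" where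
  "realises ms h p \<longleftrightarrow> inj_on h (multi_index ms) \<and>
     (\<forall>u\<in>multi_index ms. \<forall>v\<in>multi_index ms. p (h u) = p (h v) \<longleftrightarrow> fst u = fst v)"

lemma K_multi_eq_label_graph: "K_multi ms = label_graph (multi_index ms) fst"
  by (simp add: K_multi_def label_graph_def Let_def)

text \<open>The isomorphism supplies both data: a vertex is labelled by the part index of its image,
  and \<open>h\<close> is the inverse map.\<close>

lemma is_K_multi_imp:
  assumes "is_K_multi ms G"
  obtains p :: "'a \<Rightarrow> nat" and h
  where "G = label_graph (h ` multi_index ms) p" "realises ms h p"
proof -
  obtain f where f: "pre_digraph.digraph_isomorphism (with_proj G) f"
      and eq: "with_proj (K_multi ms) = app_iso f (with_proj G)"
    using assms by (auto simp: is_K_multi_def digraph_iso_def)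
  let ?V = "pverts G" and ?v = "iso_verts f"
  interpret pre_digraph "with_proj G" .
  \<comment> \<open>\<open>app_iso\<close> installs the tail and head functions stored in the
    isomorphism, and those of \<open>K_multi ms\<close> are the projections.\<close>
  have ft: "iso_tail f = fst" "iso_head f = snd"
    using arg_cong[OF eq, of tail] arg_cong[OF eq, of head] by auto
  have img: "?v ` ?V = multi_index ms"
    using arg_cong[OF eq, of verts] by (simp add: K_multi_eq_label_graph)
  have arcs_img: "iso_arcs f ` parcs G = {(x, y). x \<in> multi_index ms \<and> y \<in> multi_index ms \<and> fst x \<noteq> fst y}"
    using arg_cong[OF eq, of arcs] by (simp add: K_multi_eq_label_graph)
  have inj: "inj_on ?v ?V" and wf: "wf_digraph (with_proj G)"
    using f by (auto simp: digraph_isomorphism_def)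
  have arc: "iso_arcs f (x, y) = (?v x, ?v y)" if "(x, y) \<in> parcs G" for x y
    using f that ft by (auto simp: digraph_isomorphism_def intro!: prod_eqI)
  have V: "x \<in> ?V" "y \<in> ?V" if "(x, y) \<in> parcs G" for x y
    using wf_digraph.wellformed[OF wf, of "(x, y)"] that by auto
  have "(x, y) \<in> parcs G \<longleftrightarrow> x \<in> ?V \<and> y \<in> ?V \<and> fst (?v x) \<noteq> fst (?v y)" for x y
  proof
    assume a: "(x, y) \<in> parcs G"
    have "(?v x, ?v y) \<in> iso_arcs f ` parcs G"
      using a arc[OF a] by (metis image_eqI)
    then show "x \<in> ?V \<and> y \<in> ?V \<and> fst (?v x) \<noteq> fst (?v y)"
      using V[OF a] by (simp add: arcs_img)
  next
    assume xy: "x \<in> ?V \<and> y \<in> ?V \<and> fst (?v x) \<noteq> fst (?v y)"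
    then have "(?v x, ?v y) \<in> iso_arcs f ` parcs G"
      using img by (simp add: arcs_img) blast
    then obtain a b where ab: "(a, b) \<in> parcs G" "(?v x, ?v y) = iso_arcs f (a, b)"
      by auto
    then have "?v x = ?v a" "?v y = ?v b" using arc by auto
    then have "x = a" "y = b" using inj xy V[OF ab(1)] by (auto dest: inj_onD)
    then show "(x, y) \<in> parcs G" using ab by simp
  qed
  then have G: "G = label_graph ?V (fst \<circ> ?v)"
    by (intro pair_pre_digraph.equality) auto
  define h where "h = the_inv_into ?V ?v"
  have h: "h ` multi_index ms = ?V"
    using img inj the_inv_into_onto[OF inj] by (simp add: h_def)
  have "?v (h u) = u" if "u \<in> multi_index ms" for u
    using f_the_inv_into_f[OF inj] that img by (simp add: h_def)
  moreover have "inj_on h (multi_index ms)"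
    using inj_on_the_inv_into[OF inj] img by (simp add: h_def)
  ultimately have "realises ms h (fst \<circ> ?v)" by (simp add: realises_def)
  then show ?thesis using that G h by metis
qed

lemma realises_imp_is_K_multi:
  assumes "realises ms h p"
  shows "is_K_multi ms (label_graph (h ` multi_index ms) p)"
proof -
  let ?I = "multi_index ms" and ?H = "with_proj (label_graph (h ` multi_index ms) p)"
  have inj: "inj_on h ?I"
    and lab: "\<And>u v. u \<in> ?I \<Longrightarrow> v \<in> ?I \<Longrightarrow> p (h u) = p (h v) \<longleftrightarrow> fst u = fst v"
    using assms by (auto simp: realises_def)
  define g where "g = the_inv_into ?I h"
  have g: "g (h u) = u" if "u \<in> ?I" for u
    using that inj by (simp add: g_def the_inv_into_f_f)
  define f where "f = \<lparr>iso_verts = g, iso_arcs = map_prod g g,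
      iso_head = snd, iso_tail = fst\<rparr>"
  interpret wf_digraph ?H by (rule wf_digraph_label_graph)
  have "inj_on g (h ` ?I)" using inj by (simp add: g_def inj_on_the_inv_into)
  moreover from this this have "inj_on (map_prod g g) (h ` ?I \<times> h ` ?I)"
    by (rule map_prod_inj_on)
  then have "inj_on (map_prod g g) (parcs (label_graph (h ` ?I) p))"
    by (rule inj_on_subset) auto
  ultimately have "digraph_isomorphism f"
    unfolding digraph_isomorphism_def by (simp add: f_def wf_digraph_axioms)
  moreover have "with_proj (K_multi ms) = app_iso f ?H"
  proof -
    have "g ` h ` ?I = ?I" by (force simp: g image_image)
    moreover have "map_prod g g ` parcs (label_graph (h ` ?I) p) = parcs (K_multi ms)"
      (is "?A = ?B")
    proof (rule set_eqI)
      fix e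
      show "e \<in> ?A \<longleftrightarrow> e \<in> ?B"
      proof
        assume "e \<in> ?A"
        then obtain u v where uv: "u \<in> ?I" "v \<in> ?I" "p (h u) \<noteq> p (h v)" "e = (g (h u), g (h v))"
          by auto
        then show "e \<in> ?B" using lab[OF uv(1,2)] g[OF uv(1)] g[OF uv(2)]
          by (simp add: K_multi_eq_label_graph)
      next
        assume "e \<in> ?B"
        then obtain u v where uv: "u \<in> ?I" "v \<in> ?I" "fst u \<noteq> fst v" "e = (u, v)"
          unfolding K_multi_eq_label_graph by auto
        then have "(h u, h v) \<in> parcs (label_graph (h ` ?I) p)" using lab[OF uv(1,2)] by auto
        moreover have "e = map_prod g g (h u, h v)" using uv g[OF uv(1)] g[OF uv(2)] by simp
        ultimately show "e \<in> ?A" by blast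
      qed
    qed
    ultimately show ?thesis
      by (intro pre_digraph.equality) (simp_all add: f_def K_multi_eq_label_graph)
  qed
  ultimately show ?thesis unfolding is_K_multi_def digraph_iso_def by blast
qed

lemma realises_two_parts:
  assumes "realises ms h p" "length ms \<ge> 2" "\<forall>m\<in>set ms. m \<ge> 1"
  shows "\<forall>u\<in>h ` multi_index ms. \<exists>v\<in>h ` multi_index ms. p v \<noteq> p u"
    and "h ` multi_index ms \<noteq> {}"
proof -
  have pos: "(i, 0) \<in> multi_index ms" if "i < length ms" for i
    using that assms(3) nth_mem[OF that] by (auto simp: Suc_le_eq)
  show "h ` multi_index ms \<noteq> {}" using pos[of 0] assms(2) by (metis Suc_1 Suc_le_eq empty_iff image_is_empty not_less0 gr0I)
  show "\<forall>u\<in>h ` multi_index ms. \<exists>v\<in>h ` multi_index ms. p v \<noteq> p u"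
  proof
    fix u assume "u \<in> h ` multi_index ms"
    then obtain x where x: "x \<in> multi_index ms" "u = h x" by blast
    define j :: nat where "j = (if fst x = 0 then 1 else 0)"
    have "j < length ms" using assms(2) by (auto simp: j_def)
    then have j: "(j, 0) \<in> multi_index ms" by (rule pos)
    have "j \<noteq> fst x" by (simp add: j_def)
    then have "p (h (j, 0)) \<noteq> p u" using j assms(1) x unfolding realises_def by (metis fst_conv)
    then show "\<exists>v\<in>h ` multi_index ms. p v \<noteq> p u" using j by blast
  qed
qed

section \<open>Explicit embeddings\<close>

text \<open>Posing the problem for \<open>label_dist\<close> rather than for a graph also covers
  sets with a single label, where the labelled graph may be disconnected.\<close>

definition embeddable :: "'a set \<Rightarrow> ('a \<Rightarrow> 'b) \<Rightarrow> bool" where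
  "embeddable S p \<longleftrightarrow> (\<exists>(N::nat) \<phi>. \<forall>x\<in>S. \<forall>y\<in>S.
     (\<Sum>i<N. (\<phi> x i - \<phi> y i)\<^sup>2) = label_dist p x y)"

lemma embeddableI:
  fixes \<phi> :: "'a \<Rightarrow> 'i \<Rightarrow> real"
  assumes "finite I"
    and emb: "\<And>x y. x \<in> S \<Longrightarrow> y \<in> S \<Longrightarrow> (\<Sum>i\<in>I. (\<phi> x i - \<phi> y i)\<^sup>2) = label_dist p x y"
  shows "embeddable S p"
proof -
  obtain e where e: "bij_betw e {..<card I} I"
    using ex_bij_betw_nat_finite[OF assms(1)] by (auto simp: atLeast0LessThan)
  have "(\<Sum>i<card I. (\<phi> x (e i) - \<phi> y (e i))\<^sup>2) = label_dist p x y" if "x \<in> S" "y \<in> S" for x y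
    using sum.reindex_bij_betw[OF e, of "\<lambda>i. (\<phi> x i - \<phi> y i)\<^sup>2"] emb[OF that] by simp
  then show ?thesis unfolding embeddable_def
    by (intro exI[of _ "card I"] exI[of _ "\<lambda>x i. \<phi> x (e i)"]) blast
qed

text \<open>Pythagoras for multiples of two different unit vectors.\<close>

lemma sum_sq_diff_two_coords:
  fixes a b :: real
  assumes "finite I" "i \<in> I" "j \<in> I" "i \<noteq> j"
  shows "(\<Sum>k\<in>I. ((if k = i then a else 0) - (if k = j then b else 0))\<^sup>2) = a\<^sup>2 + b\<^sup>2"
proof -
  have "(\<Sum>k\<in>I. ((if k = i then a else 0) - (if k = j then b else 0))\<^sup>2) =
      (\<Sum>k\<in>I. (if k = i then a\<^sup>2 else 0) + (if k = j then b\<^sup>2 else 0))"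
    by (rule sum.cong) (use assms(4) in auto)
  then show ?thesis using assms by (simp add: sum.distrib)
qed

text \<open>A part of size two is placed at \<open>\<plusminus>e\<^sub>i / sqrt 2\<close>, so the graph sits on the
  vertices of a cross-polytope.\<close>

lemma embeddable_small_parts:
  assumes fin: "finite S" and small: "\<And>i. card {x\<in>S. p x = i} \<le> 2"
  shows "embeddable S p"
proof -
  \<comment> \<open>Each label gets a representative, placed on the positive half of its axis; any
    other vertex with that label goes to the negative half.\<close>
  define r where "r i = (SOME x. x \<in> S \<and> p x = i)" for i
  have r: "r (p x) \<in> S" "p (r (p x)) = p x" if "x \<in> S" for x
    using someI[of "\<lambda>y. y \<in> S \<and> p y = p x" x] that by (auto simp: r_def)
  define c :: "'a \<Rightarrow> real" where "c x = (if x = r (p x) then 1 else -1) / sqrt 2" for x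
  define \<phi> where "\<phi> x i = (if i = p x then c x else 0)" for x i
  have c2: "(c x)\<^sup>2 = 1/2" for x by (simp add: c_def power_divide)
  show ?thesis
  proof (rule embeddableI[of "p ` S" _ \<phi>])
    fix x y assume xy: "x \<in> S" "y \<in> S"
    consider "x = y" | "x \<noteq> y" "p x = p y" | "p x \<noteq> p y" by blast
    then show "(\<Sum>i\<in>p ` S. (\<phi> x i - \<phi> y i)\<^sup>2) = label_dist p x y"
    proof cases
      case 1
      then show ?thesis by (simp add: label_dist_def)
    next
      case 2
      \<comment> \<open>With at most two vertices per label, one of \<open>x\<close>,
        \<open>y\<close> is the representative, so their coordinates on the common axis have
        opposite signs.\<close>
      have "x = r (p x) \<or> y = r (p x)"
      proof (rule ccontr)
        assume "\<not> ?thesis"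
        then have "card {x, y, r (p x)} = 3" using 2 by auto
        moreover have "card {x, y, r (p x)} \<le> card {z\<in>S. p z = p x}"
          by (rule card_mono) (use fin xy r[OF xy(1)] 2 in auto)
        ultimately show False using small[of "p x"] by simp
      qed
      then have "(c x - c y)\<^sup>2 = 2"
        using 2 by (auto simp: c_def power2_eq_square field_simps)
      moreover have "(\<Sum>i\<in>p ` S. (\<phi> x i - \<phi> y i)\<^sup>2) =
          (\<Sum>i\<in>p ` S. if i = p x then (c x - c y)\<^sup>2 else 0)"
        by (rule sum.cong) (use 2 in \<open>auto simp: \<phi>_def\<close>)
      ultimately show ?thesis using 2 fin xy by (simp add: label_dist_def)
    next
      case 3
      then show ?thesis
        using sum_sq_diff_two_coords[of "p ` S" "p x" "p y" "c x" "c y"] fin xy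
        by (auto simp: \<phi>_def c2 label_dist_def)
    qed
  qed (use fin in simp)
qed

text \<open>The apex \<open>a\<close> goes to the origin and the leaves go to distinct unit
  vectors.\<close>

lemma embeddable_star:
  assumes "finite L" and same: "\<And>x y. x \<in> L \<Longrightarrow> y \<in> L \<Longrightarrow> p x = p y"
    and apex: "\<And>x. x \<in> L \<Longrightarrow> p x \<noteq> p a"
  shows "embeddable (insert a L) p"
proof -
  define \<phi> :: "'a \<Rightarrow> 'a \<Rightarrow> real" where "\<phi> x i = (if i = x then if x = a then 0 else 1 else 0)" for x i
  have "a \<notin> L" using apex by blast
  show ?thesis
  proof (rule embeddableI[of "insert a L" _ \<phi>])
    fix x y assume xy: "x \<in> insert a L" "y \<in> insert a L"
    show "(\<Sum>i\<in>insert a L. (\<phi> x i - \<phi> y i)\<^sup>2) = label_dist p x y"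
    proof (cases "x = y")
      case False
      have "label_dist p x y = (if x = a then 0 else 1)\<^sup>2 + (if y = a then 0 else 1)\<^sup>2"
      proof (cases "x = a \<or> y = a")
        case True
        then have "p x \<noteq> p y" using False xy apex[of x] apex[of y] by auto
        then show ?thesis using True False by (auto simp: label_dist_def)
      next
        case neither: False
        then show ?thesis using False xy same[of x y] by (simp add: label_dist_def)
      qed
      then show ?thesis
        using sum_sq_diff_two_coords[of "insert a L" x y "if x = a then 0 else 1" "if y = a then 0 else 1"]
          xy False assms(1)
        by (simp add: \<phi>_def)
    qed (simp add: label_dist_def)
  qed (use assms(1) in simp)
qed

text \<open>The extremal cases \<open>K\<^bsub>4,1,1\<^esub>\<close> (for \<open>c = b\<close>) and
  \<open>K\<^bsub>3,1,1,1\<^esub>\<close> are tight: the simplices spanned by the leaves \<open>e\<^sub>i\<close> and by the apexes lie in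
  orthogonal directions and have the same centre, and their squared circumradii add up to 1.\<close>

lemma embeddable_simplices:
  fixes g :: "'a \<Rightarrow> nat"
  assumes same: "\<And>x y. x \<in> L \<Longrightarrow> y \<in> L \<Longrightarrow> p x = p y"
    and apex: "\<And>x z. x \<in> L \<Longrightarrow> z \<in> {a, b, c} \<Longrightarrow> p x \<noteq> p z"
    and abc: "p a \<noteq> p b" "c = b \<or> p a \<noteq> p c \<and> p b \<noteq> p c"
    and g: "inj_on g L" "g ` L \<subseteq> {..<4}" "c \<noteq> b \<Longrightarrow> g ` L \<subseteq> {..<3}"
  shows "embeddable (L \<union> {a, b, c}) p"
proof -
  \<comment> \<open>The apexes are the origin, \<open>(1/2, 1/2, 1/2, 1/2)\<close> and
    \<open>(1/2, 1/2, 1/2, -1/2)\<close>; the leaves are the unit vectors selected by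
    \<open>g\<close>. The last unit vector has squared distance 3 from the third apex, so a leaf may
    occupy it only if \<open>c = b\<close>.\<close>
  define \<phi> :: "'a \<Rightarrow> nat \<Rightarrow> real" where
    "\<phi> x i = (if x = a then 0
        else if x = b then 1/2
        else if x = c then if i = 3 then -1/2 else 1/2
        else if i = g x then 1 else 0)" for x i
  have L: "x \<noteq> a" "x \<noteq> b" "x \<noteq> c" if "x \<in> L" for x using apex[OF that] by auto
  have gL: "g x \<in> {0, 1, 2, 3}" "c \<noteq> b \<Longrightarrow> g x \<noteq> 3" if "x \<in> L" for x
  proof -
    have "g x < 4" using g(2) that by auto
    then show "g x \<in> {0, 1, 2, 3}" by auto
    show "g x \<noteq> 3" if "c \<noteq> b" using g(3)[OF that] \<open>x \<in> L\<close> by auto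
  qed
  have \<phi>a: "\<phi> a i = 0" and \<phi>b: "\<phi> b i = 1/2"
    and \<phi>c: "c \<noteq> b \<Longrightarrow> \<phi> c i = (if i = 3 then -1/2 else 1/2)" for i
    using abc by (auto simp: \<phi>_def)
  have \<phi>L: "\<phi> x i = (if i = g x then 1 else 0)" if "x \<in> L" for x i
    using L[OF that] by (simp add: \<phi>_def)
  define d where "d x y = (\<Sum>i<(4::nat). (\<phi> x i - \<phi> y i)\<^sup>2)" for x y
  have d: "d x y = (\<phi> x 0 - \<phi> y 0)\<^sup>2 + (\<phi> x 1 - \<phi> y 1)\<^sup>2 + (\<phi> x 2 - \<phi> y 2)\<^sup>2 + (\<phi> x 3 - \<phi> y 3)\<^sup>2"
    for x y
    by (simp add: d_def eval_nat_numeral)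
  have d_sym: "d x y = d y x" for x y
    by (simp add: d_def power2_commute)
  have d_refl: "d x x = 0" for x
    by (simp add: d_def)
  have ab: "d a b = 1"
    by (simp add: d \<phi>a \<phi>b power2_eq_square)
  have ac_bc: "d a c = 1" "d b c = 1" if "c \<noteq> b"
    by (simp_all add: d \<phi>a \<phi>b \<phi>c[OF that] power2_eq_square)
  have mixed: "d x z = 1" if x: "x \<in> L" and z: "z \<in> {a, b, c}" for x z
  proof -
    have "d x a = 1" "d x b = 1"
      using gL(1)[OF x] by (auto simp: d \<phi>a \<phi>b \<phi>L[OF x] power2_eq_square)
    moreover have "d x c = 1" if "c \<noteq> b"
      using gL(1)[OF x] gL(2)[OF x that] by (auto simp: d \<phi>c[OF that] \<phi>L[OF x] power2_eq_square)
    ultimately show ?thesis using z by (cases "c = b") auto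
  qed
  have leaves: "d x y = 2" if "x \<in> L" "y \<in> L" "x \<noteq> y" for x y
  proof -
    have "g x \<noteq> g y" using g(1) that by (auto dest: inj_onD)
    then show ?thesis
      using sum_sq_diff_two_coords[of "{..<4}" "g x" "g y" 1 1] that g(2)
      by (simp add: d_def \<phi>L image_subset_iff)
  qed
  show ?thesis
  proof (rule embeddableI[of "{..<4::nat}" _ \<phi>])
    fix x y assume xy: "x \<in> L \<union> {a, b, c}" "y \<in> L \<union> {a, b, c}"
    have "d x y = label_dist p x y"
    proof (cases "x = y")
      case True
      then show ?thesis by (simp add: d_refl label_dist_def)
    next
      case False
      consider "x \<in> L" "y \<in> L" | "x \<in> L" "y \<in> {a, b, c}" | "y \<in> L" "x \<in> {a, b, c}"
        | "x \<in> {a, b, c}" "y \<in> {a, b, c}"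
        using xy by blast
      then show ?thesis
      proof cases
        case 1
        then show ?thesis using leaves[OF 1 False] same[OF 1] False by (simp add: label_dist_def)
      next
        case 2
        then show ?thesis using False mixed[OF 2] apex[OF 2] by (simp add: label_dist_def)
      next
        case 3
        then show ?thesis using False mixed[OF 3] apex[OF 3] d_sym[of x y] by (simp add: label_dist_def)
      next
        case 4
        have "d x y = 1 \<and> p x \<noteq> p y"
        proof (cases "c = b")
          case True
          then have "x = a \<and> y = b \<or> x = b \<and> y = a" using 4 False by (simp only: insert_iff empty_iff) argo
          then show ?thesis using ab d_sym[of b a] abc(1) by (elim disjE conjE) simp_all
        next
          case c: False
          have "x = a \<and> y = b \<or> x = b \<and> y = a \<or> x = a \<and> y = c \<or> x = c \<and> y = a \<or>
              x = b \<and> y = c \<or> x = c \<and> y = b"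
            using 4 False by (simp only: insert_iff empty_iff) argo
          then show ?thesis
            using ab ac_bc[OF c] d_sym[of b a] d_sym[of c a] d_sym[of c b] abc c by (elim disjE conjE) simp_all
        qed
        then show ?thesis using False by (simp add: label_dist_def)
      qed
    qed
    then show "(\<Sum>i<4. (\<phi> x i - \<phi> y i)\<^sup>2) = label_dist p x y" by (simp add: d_def)
  qed simp
qed

section \<open>Finding one of the four graphs among the label classes\<close>

lemma realisesI:
  assumes "distinct ls" "length ls = length ms" "finite S"
    and big: "\<And>i. i < length ms \<Longrightarrow> ms ! i \<le> card {x\<in>S. p x = ls ! i}"
  shows "\<exists>h. realises ms h p \<and> h ` multi_index ms \<subseteq> S"
proof -
  have "\<exists>f. inj_on f {..<ms ! i} \<and> f ` {..<ms ! i} \<subseteq> {x\<in>S. p x = ls ! i}"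
    if "i < length ms" for i
    using card_le_inj[of "{..<ms ! i}" "{x\<in>S. p x = ls ! i}"] big[OF that] assms(3) by auto
  then obtain f where f: "\<And>i. i < length ms \<Longrightarrow>
      inj_on (f i) {..<ms ! i} \<and> f i ` {..<ms ! i} \<subseteq> {x\<in>S. p x = ls ! i}"
    by metis
  define h where "h = (\<lambda>(i, k). f i k)"
  have h: "h u \<in> S" "p (h u) = ls ! fst u" if "u \<in> multi_index ms" for u
    using that f[of "fst u"] by (auto simp: h_def image_subset_iff)
  have lab: "p (h u) = p (h v) \<longleftrightarrow> fst u = fst v" if "u \<in> multi_index ms" "v \<in> multi_index ms" for u v
    using that h[OF that(1)] h[OF that(2)] assms(1,2) by (auto simp: nth_eq_iff_index_eq)
  have "inj_on h (multi_index ms)"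
  proof (rule inj_onI)
    fix u v assume uv: "u \<in> multi_index ms" "v \<in> multi_index ms" "h u = h v"
    then have "fst u = fst v" using lab by metis
    then show "u = v" using uv f[of "fst u"] by (auto simp: h_def dest: inj_onD)
  qed
  then show ?thesis using h lab unfolding realises_def by blast
qed

text \<open>Every label other than \<open>i\<close> that occurs on \<open>S\<close> supplies one
  singleton part.\<close>

lemma realises_one_big_part:
  assumes fin: "finite S" and m: "m \<le> card {x\<in>S. p x = i}" and k: "k \<le> card (p ` S - {i})"
  shows "\<exists>h. realises (m # replicate k 1) h p \<and> h ` multi_index (m # replicate k 1) \<subseteq> S"
proof -
  obtain A where A: "A \<subseteq> p ` S - {i}" "card A = k" "finite A"
    using k fin by (meson obtain_subset_with_card_n finite_Diff finite_imageI finite_subset)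
  obtain as where as: "set as = A" "distinct as"
    using finite_distinct_list[OF A(3)] by blast
  have len: "length as = k" using as A distinct_card by metis
  show ?thesis
  proof (rule realisesI[of "i # as"])
    fix j assume j: "j < length (m # replicate k 1)"
    show "(m # replicate k 1) ! j \<le> card {x\<in>S. p x = (i # as) ! j}"
    proof (cases j)
      case (Suc l)
      then have "l < k" using j by simp
      then have "as ! l \<in> set as" using len by simp
      then have "as ! l \<in> p ` S" using as(1) A(1) by blast
      then obtain x where "x \<in> S" "p x = as ! l" by force
      then have "{x\<in>S. p x = as ! l} \<noteq> {}" by auto
      then show ?thesis using Suc \<open>l < k\<close> fin by (simp add: Suc_le_eq card_gt_0_iff)
    qed (use m in simp)
  qed (use as A len fin in auto)
qed

abbreviation (input) primary_sizes :: "nat list set" where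
  "primary_sizes \<equiv> {[3,2], [5,1,1], [4,1,1,1], [3,1,1,1,1]}"

lemma embeddable_or_realises:
  assumes fin: "finite S"
  shows "embeddable S p \<or> (\<exists>ms\<in>primary_sizes.
    \<exists>h. realises ms h p \<and> h ` multi_index ms \<subseteq> S)"
proof (cases "\<forall>i. card {x\<in>S. p x = i} \<le> 2")
  case True
  then show ?thesis using embeddable_small_parts[OF fin, of p] by blast
next
  case False
  then obtain i where i: "3 \<le> card {x\<in>S. p x = i}" by (metis not_less_eq_eq numeral_2_eq_2 numeral_3_eq_3)
  define L where "L = {x\<in>S. p x = i}"
  define A where "A = S - L"
  have finL: "finite L" "finite A" using fin by (auto simp: L_def A_def)
  have pA: "p ` S - {i} = p ` A" by (auto simp: A_def L_def)
  show ?thesis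
  proof (cases "\<exists>j. j \<noteq> i \<and> 2 \<le> card {x\<in>S. p x = j}")
    case True
    then obtain j where j: "j \<noteq> i" "2 \<le> card {x\<in>S. p x = j}" by blast
    have "\<exists>h. realises [3,2] h p \<and> h ` multi_index [3,2] \<subseteq> S"
      by (rule realisesI[of "[i, j]"]) (use i j fin in \<open>auto simp: less_Suc_eq\<close>)
    then show ?thesis by blast
  next
    case False
    \<comment> \<open>Two elements of \<open>A\<close> with equal labels would form a second class
      of size two, excluded here. So \<open>card A\<close> counts the singleton parts next to
      \<open>L\<close>.\<close>
    have inj: "inj_on p A"
    proof (rule inj_onI, rule ccontr)
      fix x y assume xy: "x \<in> A" "y \<in> A" "p x = p y" "x \<noteq> y"
      have "card {x, y} \<le> card {z\<in>S. p z = p x}"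
        by (rule card_mono) (use xy fin in \<open>auto simp: A_def\<close>)
      then show False using False xy by (auto simp: A_def L_def)
    qed
    then have cardA: "card (p ` S - {i}) = card A" by (simp add: pA card_image)
    have S: "S = L \<union> A" by (auto simp: L_def A_def)
    have same: "p x = p y" if "x \<in> L" "y \<in> L" for x y using that by (simp add: L_def)
    have apart: "p x \<noteq> p z" if "x \<in> L" "z \<in> A" for x z using that by (auto simp: L_def A_def)
    note big = realises_one_big_part[OF fin, of _ p i]
    have i': "3 \<le> card L" using i by (simp add: L_def)
    \<comment> \<open>Since \<open>3 \<le> card L\<close>, these cases are exhaustive. Cases 0 to 3
      are embeddable; the cases 5, 4 and 6 contain \<open>[5,1,1]\<close>, \<open>[4,1,1,1]\<close>
      and \<open>[3,1,1,1,1]\<close> respectively.\<close>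
    consider (0) "card A = 0" | (1) "card A = 1" | (2) "card A = 2" "card L \<le> 4" | (3) "card A = 3" "card L \<le> 3"
      | (5) "2 \<le> card A" "5 \<le> card L" | (4) "3 \<le> card A" "4 \<le> card L" | (6) "4 \<le> card A"
      by linarith
    then show ?thesis
    proof cases
      case 0
      have "embeddable S p"
      proof (rule embeddableI[of L _ "\<lambda>x i. if i = x then 1 else 0"])
        fix x y assume "x \<in> S" "y \<in> S"
        then have xy: "x \<in> L" "y \<in> L" using 0 S finL by auto
        show "(\<Sum>i\<in>L. ((if i = x then 1 else 0) - (if i = y then 1 else 0))\<^sup>2) = label_dist p x y"
          using sum_sq_diff_two_coords[OF finL(1) xy, of 1 1] same[OF xy]
          by (cases "x = y") (auto simp: label_dist_def)
      qed (use finL in simp)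
      then show ?thesis by blast
    next
      case 1
      then obtain a where "A = {a}" by (auto simp: card_1_singleton_iff)
      then have "p x \<noteq> p a" if "x \<in> L" for x using apart[OF that] by simp
      then have "embeddable (insert a L) p" by (intro embeddable_star[OF finL(1) same])
      then show ?thesis using S \<open>A = {a}\<close> by simp
    next
      case 2
      then obtain a b where ab: "A = {a, b}" "a \<noteq> b" by (auto simp: card_2_iff)
      obtain g where "inj_on g L" "g ` L \<subseteq> {..<4::nat}"
        using card_le_inj[OF finL(1), of "{..<4::nat}"] 2 by auto
      moreover have "p a \<noteq> p b" using inj ab by (auto dest: inj_onD)
      moreover have "p x \<noteq> p z" if "x \<in> L" "z \<in> {a, b, b}" for x z
        using apart[of x z] that ab by simp
      ultimately have "embeddable (L \<union> {a, b, b}) p"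
        by (intro embeddable_simplices[OF same]) auto
      then show ?thesis using S ab by simp
    next
      case 3
      then obtain a b c where abc: "A = {a, b, c}" "a \<noteq> b" "a \<noteq> c" "b \<noteq> c" by (auto simp: card_3_iff)
      obtain g where g: "inj_on g L" "g ` L \<subseteq> {..<3::nat}"
        using card_le_inj[OF finL(1), of "{..<3::nat}"] 3 by auto
      have "p a \<noteq> p b" "p a \<noteq> p c" "p b \<noteq> p c" using inj abc by (auto dest: inj_onD)
      moreover have "g ` L \<subseteq> {..<4}" using g(2) by (auto simp: subset_iff)
      moreover have "p x \<noteq> p z" if "x \<in> L" "z \<in> {a, b, c}" for x z
        using apart[of x z] that abc by simp
      ultimately have "embeddable (L \<union> {a, b, c}) p"
        using g by (intro embeddable_simplices[OF same]) auto
      then show ?thesis using S abc by simp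
    next
      case 5
      then show ?thesis using big[of 5 2] cardA by (auto simp: L_def numeral_eq_Suc)
    next
      case 4
      then show ?thesis using big[of 4 3] cardA by (auto simp: L_def numeral_eq_Suc)
    next
      case 6
      then show ?thesis using big[of 3 4] cardA i by (auto simp: numeral_eq_Suc)
    qed
  qed
qed

section \<open>QE constants\<close>

definition dist_form :: "'a pair_pre_digraph \<Rightarrow> ('a \<Rightarrow> real) \<Rightarrow> real" where
  "dist_form G f = (\<Sum>x\<in>pverts G. f x * (\<Sum>y\<in>pverts G. gdist G x y * f y))"

text \<open>The easy half of Schoenberg's criterion. In each coordinate the squared difference is
  expanded; the pure squares are multiplied by the zero sum of \<open>f\<close>, and only minus
  twice a square remains.\<close>

lemma quadratic_embedding_imp_dist_form_nonpos:
  assumes emb: "quadratic_embedding G N \<phi>" and zero: "(\<Sum>x\<in>pverts G. f x) = 0"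
  shows "dist_form G f \<le> 0"
proof -
  let ?V = "pverts G"
  have coord: "(\<Sum>x\<in>?V. \<Sum>y\<in>?V. f x * f y * (\<phi> x i - \<phi> y i)\<^sup>2) = - 2 * (\<Sum>x\<in>?V. f x * \<phi> x i)\<^sup>2" for i
  proof -
    have "(\<Sum>x\<in>?V. \<Sum>y\<in>?V. f x * f y * (\<phi> x i - \<phi> y i)\<^sup>2) =
        (\<Sum>x\<in>?V. \<Sum>y\<in>?V. (f x * (\<phi> x i)\<^sup>2) * f y) + (\<Sum>x\<in>?V. \<Sum>y\<in>?V. f x * (f y * (\<phi> y i)\<^sup>2))
        - 2 * (\<Sum>x\<in>?V. \<Sum>y\<in>?V. (f x * \<phi> x i) * (f y * \<phi> y i))"
      by (simp add: sum.distrib[symmetric] sum_subtractf[symmetric] sum_distrib_left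
          power2_eq_square algebra_simps)
    also have "\<dots> = - 2 * (\<Sum>x\<in>?V. f x * \<phi> x i)\<^sup>2"
      by (simp only: sum_product[symmetric] zero power2_eq_square)
    finally show ?thesis .
  qed
  have "dist_form G f = (\<Sum>x\<in>?V. \<Sum>y\<in>?V. f x * f y * gdist G x y)"
    by (simp add: dist_form_def sum_distrib_left mult_ac)
  also have "\<dots> = (\<Sum>x\<in>?V. \<Sum>y\<in>?V. f x * f y * (\<Sum>i<N. (\<phi> x i - \<phi> y i)\<^sup>2))"
    by (intro sum.cong refl) (use emb in \<open>simp add: quadratic_embedding_def\<close>)
  also have "\<dots> = (\<Sum>i<N. \<Sum>x\<in>?V. \<Sum>y\<in>?V. f x * f y * (\<phi> x i - \<phi> y i)\<^sup>2)"
    unfolding sum_distrib_left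
    by (subst sum.swap[of _ "{..<N}"], subst sum.swap[of _ "{..<N}"]) (rule refl)
  also have "\<dots> \<le> 0" by (simp add: coord sum_nonpos)
  finally show ?thesis .
qed

section \<open>The distance form of a complete multipartite graph in terms of part sums\<close>

definition part_sum :: "nat list \<Rightarrow> (nat \<times> nat \<Rightarrow> real) \<Rightarrow> nat \<Rightarrow> real" where
  "part_sum ms f i = (\<Sum>k<ms ! i. f (i, k))"

lemma sum_multi_index:
  "(\<Sum>u\<in>multi_index ms. F u) = (\<Sum>i<length ms. \<Sum>k<ms ! i. F (i, k))"
  by (subst sum.Sigma) (auto simp: case_prod_unfold)

lemma K_multi_two_parts:
  assumes "length ms \<ge> 2" "\<forall>m\<in>set ms. m \<ge> 1"
  shows "\<forall>u\<in>multi_index ms. \<exists>v\<in>multi_index ms. fst v \<noteq> fst u"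
  using realises_two_parts(1)[of ms id fst] assms by (simp add: realises_def)

text \<open>The distance matrix is \<open>J + P - 2 I\<close>, with \<open>J\<close> the all-ones
  matrix and \<open>P\<close> the indicator of lying in the same part. On zero-sum vectors
  \<open>J\<close> vanishes and \<open>P\<close> contributes the squared part sums.\<close>

lemma dist_form_K_multi:
  assumes "length ms \<ge> 2" "\<forall>m\<in>set ms. m \<ge> 1" and zero: "(\<Sum>u\<in>multi_index ms. f u) = 0"
  shows "dist_form (K_multi ms) f =
    (\<Sum>i<length ms. (part_sum ms f i)\<^sup>2) - 2 * (\<Sum>u\<in>multi_index ms. (f u)\<^sup>2)"
proof -
  let ?I = "multi_index ms"
  have fin: "finite ?I" by simp
  have row: "(\<Sum>v\<in>?I. label_dist fst u v * f v) = part_sum ms f (fst u) - 2 * f u" if u: "u \<in> ?I" for u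
  proof -
    have "(\<Sum>v\<in>?I. label_dist fst u v * f v) =
        (\<Sum>v\<in>?I. f v + (if fst v = fst u then f v else 0) - (if v = u then 2 * f v else 0))"
      by (rule sum.cong) (auto simp: label_dist_def)
    also have "\<dots> = (\<Sum>v\<in>?I. if fst v = fst u then f v else 0) - 2 * f u"
      using u fin by (simp add: sum.distrib sum_subtractf zero del: finite_SigmaI)
    also have "(\<Sum>v\<in>?I. if fst v = fst u then f v else 0) = (\<Sum>i<length ms. if i = fst u then part_sum ms f i else 0)"
      unfolding sum_multi_index by (rule sum.cong) (auto simp: part_sum_def)
    also have "\<dots> = part_sum ms f (fst u)" using u by auto
    finally show ?thesis .
  qed
  have "dist_form (K_multi ms) f = (\<Sum>u\<in>?I. f u * (\<Sum>v\<in>?I. label_dist fst u v * f v))"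
    unfolding dist_form_def K_multi_eq_label_graph pverts_label_graph
    by (intro sum.cong refl arg_cong2[of _ _ _ _ "(*)"])
       (auto simp: gdist_label_graph[OF _ _ K_multi_two_parts[OF assms(1,2)]])
  also have "\<dots> = (\<Sum>u\<in>?I. f u * part_sum ms f (fst u) - 2 * (f u)\<^sup>2)"
    by (rule sum.cong[OF refl], subst row) (auto simp: power2_eq_square algebra_simps)
  also have "\<dots> = (\<Sum>u\<in>?I. f u * part_sum ms f (fst u)) - 2 * (\<Sum>u\<in>?I. (f u)\<^sup>2)"
    by (simp add: sum_subtractf sum_distrib_left)
  also have "(\<Sum>u\<in>?I. f u * part_sum ms f (fst u)) = (\<Sum>i<length ms. (part_sum ms f i)\<^sup>2)"
    unfolding sum_multi_index
    by (simp add: part_sum_def sum_distrib_right[symmetric] power2_eq_square)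
  finally show ?thesis .
qed

text \<open>Spreading \<open>s i\<close> evenly over its part is the equality case of
  Cauchy-Schwarz.\<close>

lemma part_sum_constant:
  assumes "i < length ms" "\<forall>m\<in>set ms. m \<ge> 1"
  shows "part_sum ms (\<lambda>u. s (fst u) / real (ms ! fst u)) i = s i"
proof -
  have "ms ! i \<ge> 1" using assms by simp
  then show ?thesis by (simp add: part_sum_def)
qed

lemma sum_sq_ge_part_sums:
  assumes "\<forall>m\<in>set ms. m \<ge> 1"
  shows "(\<Sum>i<length ms. (part_sum ms f i)\<^sup>2 / real (ms ! i)) \<le> (\<Sum>u\<in>multi_index ms. (f u)\<^sup>2)"
  unfolding sum_multi_index
proof (rule sum_mono)
  fix i assume "i \<in> {..<length ms}"
  then have "ms ! i \<ge> 1" using assms by simp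
  then show "(part_sum ms f i)\<^sup>2 / real (ms ! i) \<le> (\<Sum>k<ms ! i. (f (i, k))\<^sup>2)"
    using sum_squared_le_sum_of_squares[of "\<lambda>k. f (i, k)" "{..<ms ! i}"]
    by (simp add: part_sum_def divide_le_eq)
qed

text \<open>Reduces a QE constant to an inequality between quadratic forms in the part sums together
  with a nonzero equality case. The second conclusion keeps a maximiser, so that a positive
  \<open>q\<close> later excludes embeddings.\<close>

lemma QEC_K_multi_eqI:
  assumes len: "length ms \<ge> 2" and pos: "\<forall>m\<in>set ms. m \<ge> 1" and q: "q \<ge> - 2"
    and bound: "\<And>s. (\<Sum>i<length ms. s i) = 0 \<Longrightarrow>
      (\<Sum>i<length ms. (s i)\<^sup>2) \<le> (2 + q) * (\<Sum>i<length ms. (s i)\<^sup>2 / real (ms ! i))"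
    and s: "(\<Sum>i<length ms. s i) = 0" "j < length ms" "s j \<noteq> 0"
      "(\<Sum>i<length ms. (s i)\<^sup>2) = (2 + q) * (\<Sum>i<length ms. (s i)\<^sup>2 / real (ms ! i))"
  shows "QEC (K_multi ms) = q"
    and "\<exists>f. (\<Sum>x\<in>pverts (K_multi ms). f x) = 0 \<and> dist_form (K_multi ms) f = q"
proof -
  let ?I = "multi_index ms"
  have V: "pverts (K_multi ms) = ?I" by (simp add: K_multi_eq_label_graph)
  have upper: "dist_form (K_multi ms) f \<le> q" if "(\<Sum>u\<in>?I. f u * f u) = 1" "(\<Sum>u\<in>?I. f u) = 0" for f
  proof -
    have "(\<Sum>i<length ms. part_sum ms f i) = 0"
      using that(2) by (simp add: sum_multi_index part_sum_def)
    then have "(\<Sum>i<length ms. (part_sum ms f i)\<^sup>2) \<le>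
        (2 + q) * (\<Sum>i<length ms. (part_sum ms f i)\<^sup>2 / real (ms ! i))"
      by (rule bound)
    also have "\<dots> \<le> (2 + q) * (\<Sum>u\<in>?I. (f u)\<^sup>2)"
      using sum_sq_ge_part_sums[OF pos] q by (intro mult_left_mono) auto
    finally show ?thesis
      using dist_form_K_multi[OF len pos that(2)] that(1) by (simp add: power2_eq_square)
  qed
  \<comment> \<open>\<open>c\<close> is the norm of the vector that spreads each \<open>s i\<close>
    evenly over its part; dividing by it gives the unit vector \<open>f\<close>.\<close>
  define c where "c = sqrt (\<Sum>i<length ms. (s i)\<^sup>2 / real (ms ! i))"
  have "0 < (\<Sum>i<length ms. (s i)\<^sup>2 / real (ms ! i))"
  proof (rule sum_pos2[of _ j])
    have "ms ! j \<ge> 1" using pos s(2) by simp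
    then show "0 < (s j)\<^sup>2 / real (ms ! j)" using s(3) by simp
  qed (use s(2) in auto)
  then have c: "c \<noteq> 0" "c\<^sup>2 = (\<Sum>i<length ms. (s i)\<^sup>2 / real (ms ! i))" by (auto simp: c_def)
  define f where "f u = (s (fst u) / c) / real (ms ! fst u)" for u :: "nat \<times> nat"
  have ps: "part_sum ms f i = s i / c" if "i < length ms" for i
    using part_sum_constant[OF that pos, of "\<lambda>i. s i / c"] by (simp add: f_def[abs_def])
  have f0: "(\<Sum>u\<in>?I. f u) = 0"
    using s(1) ps by (simp add: sum_multi_index part_sum_def[symmetric] sum_divide_distrib[symmetric])
  have "(\<Sum>u\<in>?I. (f u)\<^sup>2) = (\<Sum>i<length ms. (s i)\<^sup>2 / real (ms ! i) / c\<^sup>2)"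
    unfolding sum_multi_index
    by (rule sum.cong) (auto simp: f_def power2_eq_square)
  also have "\<dots> = c\<^sup>2 / c\<^sup>2" unfolding c(2) sum_divide_distrib ..
  finally have f1: "(\<Sum>u\<in>?I. (f u)\<^sup>2) = 1" using c(1) by simp
  have "(\<Sum>i<length ms. (part_sum ms f i)\<^sup>2) = (\<Sum>i<length ms. (s i)\<^sup>2) / c\<^sup>2"
    by (simp add: ps power_divide sum_divide_distrib)
  also have "\<dots> = 2 + q" unfolding s(4) c(2)[symmetric] using c(1) by simp
  finally have val: "dist_form (K_multi ms) f = q"
    using dist_form_K_multi[OF len pos f0] f1 by simp
  then show "\<exists>f. (\<Sum>x\<in>pverts (K_multi ms). f x) = 0 \<and> dist_form (K_multi ms) f = q"
    using f0 V by auto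
  show "QEC (K_multi ms) = q"
    unfolding QEC_def
  proof (rule Greatest_equality)
    show "\<exists>f. (\<Sum>x\<in>pverts (K_multi ms). f x * f x) = 1 \<and> (\<Sum>x\<in>pverts (K_multi ms). f x) = 0 \<and>
        q = (\<Sum>x\<in>pverts (K_multi ms). f x * (\<Sum>y\<in>pverts (K_multi ms). gdist (K_multi ms) x y * f y))"
      using val f0 f1 V by (intro exI[of _ f]) (simp add: dist_form_def power2_eq_square)
  qed (use upper V in \<open>auto simp: dist_form_def\<close>)
qed

text \<open>With two parts, the zero-sum condition leaves one parameter \<open>s 0\<close>, and both
  sides equal twice its square because 12/5 times (1/3 + 1/2) is 2.\<close>

lemma QEC_K32:
  shows "QEC (K_multi [3,2]) = 2/5"
    and "\<exists>f. (\<Sum>x\<in>pverts (K_multi [3,2]). f x) = 0 \<and> dist_form (K_multi [3,2]) f = 2/5"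
proof -
  have bound: "(\<Sum>i<length [3,2::nat]. (s i)\<^sup>2)
      \<le> (2 + 2/5) * (\<Sum>i<length [3,2::nat]. (s i)\<^sup>2 / real ([3,2] ! i))"
    if "(\<Sum>i<length [3,2::nat]. s i) = 0" for s :: "nat \<Rightarrow> real"
  proof -
    have "s 1 = - s 0" using that by (simp add: eval_nat_numeral)
    then show ?thesis by (simp add: numeral_2_eq_2)
  qed
  note eq = QEC_K_multi_eqI[where s = "\<lambda>i. if i = 0 then -1 else 1" and j = 0]
  show "QEC (K_multi [3,2]) = 2/5"
    by (rule eq(1)) (use bound in simp_all)
  show "\<exists>f. (\<Sum>x\<in>pverts (K_multi [3,2]). f x) = 0 \<and> dist_form (K_multi [3,2]) f = 2/5"
    by (rule eq(2)) (use bound in simp_all)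
qed

text \<open>Let \<open>x\<close> be the sum over the big part and \<open>y\<close> the sum of the
  squares over the singletons. The zero-sum condition and Cauchy-Schwarz give
  \<open>x\<^sup>2 \<le> k y\<close>, and the value of \<open>q\<close> is the one that makes the
  equality case tight.\<close>

lemma QEC_K_big_part:
  fixes m k :: nat and q :: real
  assumes "m \<ge> 1" "k \<ge> 1" and q: "q = (real m * k - m - 2 * k) / (real m + k)"
  defines "ms \<equiv> m # replicate k 1"
  shows "QEC (K_multi ms) = q"
    and "\<exists>f. (\<Sum>x\<in>pverts (K_multi ms). f x) = 0 \<and> dist_form (K_multi ms) f = q"
proof -
  have sums: "(\<Sum>i<length ms. F i) = F 0 + (\<Sum>i<k. F (Suc i))" for F :: "nat \<Rightarrow> real"
    by (simp add: ms_def sum.lessThan_Suc_shift del: sum.lessThan_Suc)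
  have q2: "2 + q = (real m * k + m) / (real m + k)"
    using assms(1) by (simp add: q field_simps)
  have wsum: "(\<Sum>i<length ms. (s i)\<^sup>2 / real (ms ! i)) = (s 0)\<^sup>2 / m + (\<Sum>i<k. (s (Suc i))\<^sup>2)"
    for s :: "nat \<Rightarrow> real"
    unfolding sums by (simp add: ms_def)
  \<comment> \<open>The slack in the required bound is a nonnegative multiple of the Cauchy-Schwarz
    gap, so bound and equality case both follow from this identity.\<close>
  have key: "(2 + q) * (x\<^sup>2 / m + y) - (x\<^sup>2 + y) = (real m - 1) / (real m + k) * (k * y - x\<^sup>2)" for x y :: real
  proof -
    have "real m \<noteq> 0" "real m + k \<noteq> 0" using assms(1) by auto
    then show ?thesis unfolding q2 by (simp add: divide_simps) (simp add: algebra_simps)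
  qed
  have len: "length ms \<ge> 2" and pos: "\<forall>m\<in>set ms. m \<ge> 1" using assms(1,2) by (auto simp: ms_def)
  have "2 + q \<ge> 0" unfolding q2 by simp
  then have q': "q \<ge> - 2" by simp
  have bound: "(\<Sum>i<length ms. (s i)\<^sup>2) \<le> (2 + q) * (\<Sum>i<length ms. (s i)\<^sup>2 / real (ms ! i))"
    if "(\<Sum>i<length ms. s i) = 0" for s :: "nat \<Rightarrow> real"
  proof -
    have "(s 0)\<^sup>2 = (\<Sum>i<k. s (Suc i))\<^sup>2" using that unfolding sums by (simp add: power2_eq_iff add_eq_0_iff2)
    also have "\<dots> \<le> k * (\<Sum>i<k. (s (Suc i))\<^sup>2)"
      using sum_squared_le_sum_of_squares[of "\<lambda>i. s (Suc i)" "{..<k}"] by (simp add: mult.commute)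
    finally have "0 \<le> (real m - 1) / (real m + k) * (k * (\<Sum>i<k. (s (Suc i))\<^sup>2) - (s 0)\<^sup>2)"
      using assms(1) by (intro mult_nonneg_nonneg) auto
    then show ?thesis using key[of "s 0" "\<Sum>i<k. (s (Suc i))\<^sup>2"] unfolding wsum sums by simp
  qed
  \<comment> \<open>Equal values on the singletons close the Cauchy-Schwarz gap: here
    \<open>x\<^sup>2 = k\<^sup>2\<close> and \<open>y = k\<close>.\<close>
  define s :: "nat \<Rightarrow> real" where "s i = (if i = 0 then - real k else 1)" for i
  have s: "(\<Sum>i<length ms. s i) = 0" "s 0 \<noteq> 0" "0 < length ms"
    using assms(2) unfolding sums by (auto simp: s_def ms_def)
  have eq: "(\<Sum>i<length ms. (s i)\<^sup>2) = (2 + q) * (\<Sum>i<length ms. (s i)\<^sup>2 / real (ms ! i))"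
    using key[of "real k" "real k"] unfolding wsum sums by (simp add: s_def power2_eq_square)
  show "QEC (K_multi ms) = q"
    "\<exists>f. (\<Sum>x\<in>pverts (K_multi ms). f x) = 0 \<and> dist_form (K_multi ms) f = q"
    using QEC_K_multi_eqI[OF len pos q' bound s(1) s(3) s(2) eq] by auto
qed

lemma QEC_K511_K4111_K31111:
  shows "QEC (K_multi [5,1,1]) = 1/7" "QEC (K_multi [4,1,1,1]) = 2/7" "QEC (K_multi [3,1,1,1,1]) = 1/7"
  using QEC_K_big_part(1)[of 5 2 "1/7"] QEC_K_big_part(1)[of 4 3 "2/7"] QEC_K_big_part(1)[of 3 4 "1/7"]
  by (simp_all add: numeral_eq_Suc)

text \<open>For the graphs with one big part, the sign is that of the numerator of \<open>q\<close>:
  the condition \<open>m * k > m + 2 * k\<close> reads 10 > 9, 12 > 10 and 12 > 11.\<close>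

lemma primary_dist_form_pos:
  assumes "ms \<in> primary_sizes"
  shows "\<exists>f. (\<Sum>x\<in>pverts (K_multi ms). f x) = 0 \<and> dist_form (K_multi ms) f > 0"
proof -
  have pos: "\<exists>f. (\<Sum>x\<in>pverts (K_multi (m # replicate k 1)). f x) = 0 \<and>
      dist_form (K_multi (m # replicate k 1)) f > 0" if "m \<ge> 1" "k \<ge> 1" "m * k > m + 2 * k" for m k
  proof -
    have "0 < real m * k - m - 2 * k" using that(3) by (simp flip: of_nat_mult of_nat_add)
    then have "0 < (real m * k - m - 2 * k) / (real m + k)" using that by (intro divide_pos_pos) auto
    then show ?thesis using QEC_K_big_part(2)[OF that(1,2) refl] by metis
  qed
  show ?thesis
    using assms QEC_K32(2) pos[of 5 2] pos[of 4 3] pos[of 3 4]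
    by (auto simp: numeral_eq_Suc)
qed

section \<open>Primary graphs\<close>

lemma primary_sizes_ge:
  assumes "ms \<in> primary_sizes"
  shows "length ms \<ge> 2" "\<forall>m\<in>set ms. m \<ge> 1"
  using assms by auto

lemma embeddable_imp_QE_class:
  assumes "connected_graph H" "embeddable (pverts H) p"
    and "\<And>x y. x \<in> pverts H \<Longrightarrow> y \<in> pverts H \<Longrightarrow> gdist H x y = label_dist p x y"
  shows "QE_class H"
  using assms unfolding QE_class_def quadratic_embedding_def embeddable_def by metis

lemma finite_realised: "finite (h ` multi_index ms)"
  by simp

lemma realises_dist:
  assumes "realises ms h p" "u \<in> multi_index ms" "v \<in> multi_index ms"
  shows "label_dist p (h u) (h v) = label_dist fst u v"
  using assms by (auto simp: realises_def label_dist_def dest: inj_onD)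

text \<open>An embedding of the copy pulls back along \<open>h\<close> to one of
  \<open>K_multi ms\<close>, where a zero-sum vector with positive form forbids it.\<close>

lemma non_QE_primary_size:
  assumes ms: "ms \<in> primary_sizes" and h: "realises ms h p"
  shows "non_QE_class (label_graph (h ` multi_index ms) p)"
proof -
  let ?V = "h ` multi_index ms" and ?K = "K_multi ms"
  note two = realises_two_parts[OF h primary_sizes_ge[OF ms]]
  have V: "pverts ?K = multi_index ms" by (simp add: K_multi_eq_label_graph)
  have "\<not> quadratic_embedding (label_graph ?V p) N \<phi>" for N \<phi>
  proof
    assume emb: "quadratic_embedding (label_graph ?V p) N \<phi>"
    have "quadratic_embedding ?K N (\<phi> \<circ> h)"
      unfolding quadratic_embedding_def V
    proof (intro ballI)
      fix u v assume uv: "u \<in> multi_index ms" "v \<in> multi_index ms"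
      have "(\<Sum>i<N. (\<phi> (h u) i - \<phi> (h v) i)\<^sup>2) = gdist (label_graph ?V p) (h u) (h v)"
        using emb uv unfolding quadratic_embedding_def pverts_label_graph by blast
      also have "\<dots> = label_dist p (h u) (h v)"
        using uv by (intro gdist_label_graph two) auto
      also have "\<dots> = gdist ?K u v"
        unfolding K_multi_eq_label_graph
        using realises_dist[OF h uv] gdist_label_graph[OF uv K_multi_two_parts[OF primary_sizes_ge[OF ms]]]
        by simp
      finally show "(\<Sum>i<N. ((\<phi> \<circ> h) u i - (\<phi> \<circ> h) v i)\<^sup>2) = gdist ?K u v" by simp
    qed
    then show False
      using primary_dist_form_pos[OF ms] quadratic_embedding_imp_dist_form_nonpos by (metis not_le)
  qed
  then show ?thesis
    using connected_label_graph[OF finite_realised two(2,1)]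
    by (simp add: non_QE_class_def QE_class_def)
qed

text \<open>Both distances are \<open>label_dist p\<close>, as \<open>U\<close> and \<open>V\<close>
  each contain a second label for every vertex.\<close>

lemma isometric_label_subgraph:
  assumes "finite V" "U \<subseteq> V" "U \<noteq> {}" and U: "\<forall>u\<in>U. \<exists>v\<in>U. p v \<noteq> p u"
    and V: "\<forall>u\<in>V. \<exists>v\<in>V. p v \<noteq> p u"
  shows "isometric_subgraph (label_graph U p) (label_graph V p)"
proof -
  have "gdist (label_graph U p) x y = gdist (label_graph V p) x y" if "x \<in> U" "y \<in> U" for x y
    using gdist_label_graph[OF that U] gdist_label_graph[OF _ _ V] that assms(2) by (simp add: subset_iff)
  moreover have "subgraph (with_proj (label_graph U p)) (with_proj (label_graph V p))"
    using assms(2) wf_digraph_label_graph by (auto simp: subgraph_def)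
  ultimately show ?thesis
    using connected_label_graph[OF finite_subset[OF assms(2,1)] assms(3) U]
    by (simp add: isometric_subgraph_def)
qed

text \<open>That \<open>H\<close> is itself of non-QE class is recorded because a primary
  \<open>G\<close> must then coincide with it.\<close>

lemma non_QE_contains_primary_size:
  assumes "complete_multipartite G" "non_QE_class G"
  shows "\<exists>H. isometric_subgraph H G \<and> (\<exists>ms\<in>primary_sizes. is_K_multi ms H) \<and> non_QE_class H"
proof -
  obtain ns where ns: "length ns \<ge> 2" "\<forall>m\<in>set ns. m \<ge> 1" "is_K_multi ns G"
    using assms(1) by (auto simp: complete_multipartite_def)
  from ns(3) obtain p :: "'a \<Rightarrow> nat" and h
    where G: "G = label_graph (h ` multi_index ns) p" and h: "realises ns h p"
    by (rule is_K_multi_imp)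
  let ?V = "h ` multi_index ns"
  note two = realises_two_parts(1)[OF h ns(1,2)]
  have "\<not> embeddable ?V p"
  proof
    assume "embeddable ?V p"
    then have "QE_class G"
      using assms(2) gdist_label_graph[OF _ _ two] unfolding G
      by (intro embeddable_imp_QE_class[of _ p]) (auto simp: non_QE_class_def)
    then show False using assms(2) by (simp add: non_QE_class_def)
  qed
  then obtain ms k where ms: "ms \<in> primary_sizes" and k: "realises ms k p" "k ` multi_index ms \<subseteq> ?V"
    using embeddable_or_realises[OF finite_realised, of h ns p] by blast
  let ?H = "label_graph (k ` multi_index ms) p"
  have "isometric_subgraph ?H G"
    unfolding G using realises_two_parts[OF k(1) primary_sizes_ge[OF ms]] k(2) two
    by (intro isometric_label_subgraph) auto
  then show ?thesis
    using realises_imp_is_K_multi[OF k(1)] non_QE_primary_size[OF ms k(1)] ms by blast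
qed

lemma card_multi_index: "card (multi_index ms) = sum_list ms"
proof -
  have "card (multi_index ms) = (\<Sum>i<length ms. ms ! i)" by simp
  then show ?thesis by (simp add: sum_list_sum_nth atLeast0LessThan)
qed

text \<open>A proper subset of seven vertices could only realise \<open>[3,2]\<close>, but
  only one part of the three larger graphs has more than one element.\<close>

lemma not_realises_proper_subset:
  assumes ms: "ms \<in> primary_sizes" and h: "realises ms h p"
    and ns: "ns \<in> primary_sizes" and k: "realises ns k p" and sub: "k ` multi_index ns \<subset> h ` multi_index ms"
  shows False
proof -
  have inj: "inj_on h (multi_index ms)" "inj_on k (multi_index ns)"
    using h k by (auto simp: realises_def)
  have "card (k ` multi_index ns) < card (h ` multi_index ms)"
    using sub by (intro psubset_card_mono) auto
  then have "sum_list ns < sum_list ms"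
    by (simp only: card_image inj card_multi_index)
  then have ns32: "ns = [3,2]" and big: "\<And>i. 0 < i \<Longrightarrow> i < length ms \<Longrightarrow> ms ! i = 1"
    using ms ns by (auto simp: less_Suc_eq numeral_eq_Suc)
  have "\<exists>u\<in>multi_index ms. k v = h u" if "v \<in> multi_index ns" for v using sub that by blast
  \<comment> \<open>\<open>g\<close> rewrites the copy of \<open>K_multi ns\<close> in the indices
    of \<open>ms\<close>; it is injective and two indices share a part exactly when their images
    do.\<close>
  then obtain g where g: "\<And>v. v \<in> multi_index ns \<Longrightarrow> g v \<in> multi_index ms \<and> k v = h (g v)"
    by metis
  have fst_g: "fst (g u) = fst (g v) \<longleftrightarrow> fst u = fst v"
    if "u \<in> multi_index ns" "v \<in> multi_index ns" for u v
    using h k g[OF that(1)] g[OF that(2)] that unfolding realises_def by metis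
  have g_ne: "g u \<noteq> g v" if "u \<in> multi_index ns" "v \<in> multi_index ns" "u \<noteq> v" for u v
    using inj(2) g[OF that(1)] g[OF that(2)] that by (metis inj_onD)
  \<comment> \<open>Both parts of \<open>[3,2]\<close> contain the two elements
    \<open>(i, 0)\<close> and \<open>(i, 1)\<close>, so each must land in part 0 of
    \<open>ms\<close>, the only one with room for two. But different parts cannot land in the same
    one.\<close>
  have zero: "fst (g (i, 0)) = 0" if "i < 2" for i
  proof (rule ccontr)
    assume ne: "fst (g (i, 0)) \<noteq> 0"
    have mem: "(i, 0) \<in> multi_index ns" "(i, 1) \<in> multi_index ns"
      using that by (auto simp: ns32 less_Suc_eq numeral_2_eq_2)
    have "fst (g (i, 1)) = fst (g (i, 0))" using fst_g[OF mem] by simp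
    moreover have "snd (g (i, 0)) = 0" "snd (g (i, 1)) = 0"
      using g[OF mem(1)] g[OF mem(2)] big ne calculation by (auto simp: mem_Sigma_iff prod_eq_iff split: prod.splits)
    ultimately have "g (i, 0) = g (i, 1)" by (simp add: prod_eq_iff)
    then show False using g_ne[OF mem] by simp
  qed
  then have "fst (g (0, 0)) = fst (g (1, 0))" by simp
  then show False using fst_g[of "(0, 0)" "(1, 0)"] by (simp add: ns32)
qed

text \<open>A proper isometric subgraph \<open>H\<close> misses a vertex and inherits the distances
  of \<open>G\<close>. Only these distances enter the embedding, so the dichotomy applies to
  \<open>pverts H\<close> without describing the arcs of \<open>H\<close>.\<close>

lemma primary_non_QE_primary_size:
  assumes ms: "ms \<in> primary_sizes" and G: "is_K_multi ms G"
  shows "primary_non_QE G"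
proof -
  from G obtain p :: "'a \<Rightarrow> nat" and h
    where G: "G = label_graph (h ` multi_index ms) p" and h: "realises ms h p"
    by (rule is_K_multi_imp)
  let ?V = "h ` multi_index ms"
  note two = realises_two_parts(1)[OF h primary_sizes_ge[OF ms]]
  have "\<not> non_QE_class H" if H: "isometric_subgraph H G" "H \<noteq> G" for H
  proof -
    have sub: "pverts H \<subseteq> ?V" using H(1) by (auto simp: G isometric_subgraph_def subgraph_def)
    have "pverts H \<noteq> ?V" using isometric_subgraph_spanning_eq[OF _ two] H unfolding G by blast
    with sub have proper: "pverts H \<subset> ?V" by blast
    have "embeddable (pverts H) p"
      using embeddable_or_realises[OF finite_subset[OF sub finite_realised], of p]
        not_realises_proper_subset[OF ms h] proper by (meson subset_psubset_trans)
    moreover have "gdist H x y = label_dist p x y" if "x \<in> pverts H" "y \<in> pverts H" for x y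
      using H(1) that sub gdist_label_graph[OF _ _ two, of x y] by (auto simp: G isometric_subgraph_def)
    ultimately have "QE_class H"
      using H(1) by (intro embeddable_imp_QE_class[of _ p]) (auto simp: isometric_subgraph_def)
    then show ?thesis by (simp add: non_QE_class_def)
  qed
  then show ?thesis using non_QE_primary_size[OF ms h] by (simp add: primary_non_QE_def G)
qed

theorem theorem1p3:
  shows "(\<forall>G :: 'a pair_pre_digraph.
            complete_multipartite G \<and> primary_non_QE G \<longleftrightarrow>
            (\<exists>ms \<in> {[3,2], [5,1,1], [4,1,1,1], [3,1,1,1,1]}. is_K_multi ms G))
       \<and> QEC (K_multi [3,2]) = 2/5
       \<and> QEC (K_multi [5,1,1]) = 1/7
       \<and> QEC (K_multi [4,1,1,1]) = 2/7
       \<and> QEC (K_multi [3,1,1,1,1]) = 1/7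
       \<and> (\<forall>G :: 'a pair_pre_digraph.
            complete_multipartite G \<and> non_QE_class G \<longrightarrow>
            (\<exists>H. isometric_subgraph H G \<and>
                 (\<exists>ms \<in> {[3,2], [5,1,1], [4,1,1,1], [3,1,1,1,1]}. is_K_multi ms H)))"
proof (intro conjI allI)
  fix G :: "'a pair_pre_digraph"
  show "complete_multipartite G \<and> primary_non_QE G \<longleftrightarrow> (\<exists>ms\<in>primary_sizes. is_K_multi ms G)"
  proof
    assume "complete_multipartite G \<and> primary_non_QE G"
    \<comment> \<open>The non-QE isometric subgraph found in \<open>G\<close> cannot be proper, so
      it is \<open>G\<close> itself.\<close>
    then show "\<exists>ms\<in>primary_sizes. is_K_multi ms G"
      using non_QE_contains_primary_size[of G] unfolding primary_non_QE_def by blast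
  next
    assume "\<exists>ms\<in>primary_sizes. is_K_multi ms G"
    then obtain ms where ms: "ms \<in> primary_sizes" "is_K_multi ms G" ..
    then have "complete_multipartite G"
      using primary_sizes_ge[OF ms(1)] by (auto simp only: complete_multipartite_def)
    then show "complete_multipartite G \<and> primary_non_QE G"
      using primary_non_QE_primary_size[OF ms] by simp
  qed
  show "complete_multipartite G \<and> non_QE_class G \<longrightarrow>
      (\<exists>H. isometric_subgraph H G \<and> (\<exists>ms\<in>primary_sizes. is_K_multi ms H))"
    using non_QE_contains_primary_size[of G] by blast
qed (fact QEC_K32(1) QEC_K511_K4111_K31111)+

end
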